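(* Let $\mathcal{G}$ be a finite simplicial graph and let $\chi$ be a rational character of the graph group $G\mathcal{G}$. Then the kernel of $\chi$ is finitely generated if and only if $\mathcal{L}(\chi)$ is a connected and dominating subgraph of $\mathcal{G}$.
   Context: For a finite simplicial graph $\mathcal{G}$ with vertex set $V(\mathcal{G})$, the graph group $G\mathcal{G}$ is $\langle V(\mathcal{G}) \mid xy=yx \text{ for all adjacent } x,y\in V(\mathcal{G})\rangle$; the elements of $V(\mathcal{G})$ are the standard generators. A character of a group is a non-zero homomorphism to the additive group $\mathbb{R}$. It is rational if some positive real multiple of it is integer-valued; equivalently, its image is infinite cyclic (so $\chi$ can be regarded as a map onto an infinite cyclic group). For a character $\chi$ of $G\mathcal{G}$, the living subgraph $\mathcal{L}(\chi)$ is the full (induced) subgraph of $\mathcal{G}$ on the vertices $v$ with $\chi(v)\neq 0$. A subgraph $\mathcal{L}$ of $\mathcal{G}$ is dominating if every vertex $v$ of $\mathcal{G}$ not in $\mathcal{L}$ satisfies $d(v,\mathcal{L})=1$, i.e. is adjacent to a vertex of $\mathcal{L}$. *)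

theory Defs
  imports
    Complex_Main
    "HOL-Algebra.Generated_Groups"
    "Graph_Theory.Digraph_Component"
begin

section \<open>Groups given by generators and relations\<close>

text \<open>The letter \<open>(x, True)\<close> stands for the generator \<open>x\<close> and \<open>(x, False)\<close> for its formal inverse.\<close>

type_synonym 'a gen_word = "('a \<times> bool) list"

definition gen_words :: "'a set \<Rightarrow> 'a gen_word set" where
  "gen_words X = lists (X \<times> UNIV)"

text \<open>
  A pair \<open>(l, r) \<in> R\<close> is the relation \<open>l = r\<close>. The congruence on words generated by the relations and
  by free cancellation has as its quotient the group \<open>\<langle>X | R\<rangle>\<close>.
\<close>

inductive_set pres_cong :: "'a set \<Rightarrow> ('a gen_word \<times> 'a gen_word) set \<Rightarrow> ('a gen_word \<times> 'a gen_word) set"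
  for X R where
    refl: "w \<in> gen_words X \<Longrightarrow> (w, w) \<in> pres_cong X R"
  | sym: "(u, v) \<in> pres_cong X R \<Longrightarrow> (v, u) \<in> pres_cong X R"
  | trans: "(u, v) \<in> pres_cong X R \<Longrightarrow> (v, w) \<in> pres_cong X R \<Longrightarrow> (u, w) \<in> pres_cong X R"
  | append: "(u, u') \<in> pres_cong X R \<Longrightarrow> (v, v') \<in> pres_cong X R \<Longrightarrow> (u @ v, u' @ v') \<in> pres_cong X R"
  | cancel: "x \<in> X \<Longrightarrow> ([(x, b), (x, \<not> b)], []) \<in> pres_cong X R"
  | relation: "(l, r) \<in> R \<Longrightarrow> l \<in> gen_words X \<Longrightarrow> r \<in> gen_words X \<Longrightarrow> (l, r) \<in> pres_cong X R"

definition presented_group :: "'a set \<Rightarrow> ('a gen_word \<times> 'a gen_word) set \<Rightarrow> 'a gen_word set monoid" where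
  "presented_group X R =
     \<lparr>carrier = gen_words X // pres_cong X R,
      monoid.mult = (\<lambda>A B. \<Union>u\<in>A. \<Union>v\<in>B. pres_cong X R `` {u @ v}),
      one = pres_cong X R `` {[]}\<rparr>"

lemma gen_words_simps [simp]:
  "[] \<in> gen_words X"
  "a # w \<in> gen_words X \<longleftrightarrow> fst a \<in> X \<and> w \<in> gen_words X"
  "u @ v \<in> gen_words X \<longleftrightarrow> u \<in> gen_words X \<and> v \<in> gen_words X"
  by (auto simp: gen_words_def mem_Times_iff)

lemma pres_cong_in_words:
  "(u, v) \<in> pres_cong X R \<Longrightarrow> u \<in> gen_words X \<and> v \<in> gen_words X"
  by (induction rule: pres_cong.induct) simp_all

lemma equiv_pres_cong: "equiv (gen_words X) (pres_cong X R)"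
proof (rule equivI)
  show "pres_cong X R \<subseteq> gen_words X \<times> gen_words X"
    by (rule subrelI) (simp add: pres_cong_in_words)
  show "refl_on (gen_words X) (pres_cong X R)"
    by (simp add: refl_on_def pres_cong.refl)
  show "sym (pres_cong X R)"
    using pres_cong.sym by (rule symI)
  show "trans (pres_cong X R)"
    using pres_cong.trans by (rule transI)
qed

lemma presented_group_mult:
  assumes "u \<in> gen_words X" "v \<in> gen_words X"
  shows "pres_cong X R `` {u} \<otimes>\<^bsub>presented_group X R\<^esub> pres_cong X R `` {v} = pres_cong X R `` {u @ v}"
proof -
  let ?C = "pres_cong X R"
  have *: "?C `` {u' @ v'} = ?C `` {u @ v}" if "u' \<in> ?C `` {u}" "v' \<in> ?C `` {v}" for u' v'
    using equiv_class_eq[OF equiv_pres_cong pres_cong.append, of u u' X R v v'] that by simp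
  have "?C `` {u} \<noteq> {}" "?C `` {v} \<noteq> {}"
    using assms pres_cong.refl by (simp_all add: Image_singleton Collect_empty_eq) blast+
  then have "(\<Union>u'\<in>?C `` {u}. \<Union>v'\<in>?C `` {v}. ?C `` {u' @ v'}) = ?C `` {u @ v}"
    using * by (intro SUP_eq_const) assumption+
  then show ?thesis
    by (simp add: presented_group_def)
qed

lemma presented_group_carrierE:
  assumes "A \<in> carrier (presented_group X R)"
  obtains w where "w \<in> gen_words X" "A = pres_cong X R `` {w}"
  using assms by (auto simp: presented_group_def elim: quotientE)

lemma presented_group_carrierI:
  "w \<in> gen_words X \<Longrightarrow> pres_cong X R `` {w} \<in> carrier (presented_group X R)"
  by (auto simp: presented_group_def intro: quotientI)

lemma presented_group_one: "\<one>\<^bsub>presented_group X R\<^esub> = pres_cong X R `` {[]}"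
  by (simp add: presented_group_def)

lemma pres_cong_left_inverse:
  "w \<in> gen_words X \<Longrightarrow> \<exists>w' \<in> gen_words X. (w' @ w, []) \<in> pres_cong X R"
proof (induction w)
  case Nil
  show ?case by (auto intro!: bexI[of _ "[]"] pres_cong.refl)
next
  case (Cons a w)
  obtain x b where a: "a = (x, b)" by (cases a)
  have x: "x \<in> X" using Cons.prems a by simp
  obtain w' where w': "w' \<in> gen_words X" "(w' @ w, []) \<in> pres_cong X R"
    using Cons by auto
  have "([(x, \<not> b), (x, b)], []) \<in> pres_cong X R"
    using pres_cong.cancel[OF x, of "\<not> b"] by simp
  then have "([(x, \<not> b), (x, b)] @ w, [] @ w) \<in> pres_cong X R"
    using Cons.prems by (intro pres_cong.append pres_cong.refl) auto
  then have "(w' @ ([(x, \<not> b), (x, b)] @ w), w' @ ([] @ w)) \<in> pres_cong X R"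
    using w'(1) by (intro pres_cong.append[OF pres_cong.refl])
  then have "((w' @ [(x, \<not> b)]) @ a # w, []) \<in> pres_cong X R"
    using pres_cong.trans[of _ "w' @ w"] w'(2) a by simp
  then show ?case using w'(1) x by (intro bexI[of _ "w' @ [(x, \<not> b)]"]) auto
qed

lemma group_presented_group: "group (presented_group X R)"
proof (rule groupI)
  fix A B assume "A \<in> carrier (presented_group X R)" "B \<in> carrier (presented_group X R)"
  then show "A \<otimes>\<^bsub>presented_group X R\<^esub> B \<in> carrier (presented_group X R)"
    by (auto elim!: presented_group_carrierE simp: presented_group_mult intro!: presented_group_carrierI)
next
  show "\<one>\<^bsub>presented_group X R\<^esub> \<in> carrier (presented_group X R)"
    by (simp add: presented_group_one presented_group_carrierI)
next
  fix A B C
  assume "A \<in> carrier (presented_group X R)" "B \<in> carrier (presented_group X R)"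
    "C \<in> carrier (presented_group X R)"
  then show "A \<otimes>\<^bsub>presented_group X R\<^esub> B \<otimes>\<^bsub>presented_group X R\<^esub> C =
    A \<otimes>\<^bsub>presented_group X R\<^esub> (B \<otimes>\<^bsub>presented_group X R\<^esub> C)"
    by (auto elim!: presented_group_carrierE simp: presented_group_mult)
next
  fix A assume "A \<in> carrier (presented_group X R)"
  then show "\<one>\<^bsub>presented_group X R\<^esub> \<otimes>\<^bsub>presented_group X R\<^esub> A = A"
    by (auto elim!: presented_group_carrierE simp: presented_group_one presented_group_mult)
next
  fix A assume "A \<in> carrier (presented_group X R)"
  then obtain w where w: "w \<in> gen_words X" "A = pres_cong X R `` {w}"
    by (rule presented_group_carrierE)
  then obtain w' where w': "w' \<in> gen_words X" "(w' @ w, []) \<in> pres_cong X R"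
    using pres_cong_left_inverse by blast
  have "pres_cong X R `` {w'} \<otimes>\<^bsub>presented_group X R\<^esub> A = \<one>\<^bsub>presented_group X R\<^esub>"
    using w w' equiv_class_eq[OF equiv_pres_cong w'(2)]
    by (simp add: presented_group_mult presented_group_one)
  then show "\<exists>B \<in> carrier (presented_group X R). B \<otimes>\<^bsub>presented_group X R\<^esub> A = \<one>\<^bsub>presented_group X R\<^esub>"
    using w'(1) presented_group_carrierI by blast
qed

definition finitely_generated :: "('a, 'b) monoid_scheme \<Rightarrow> bool" where
  "finitely_generated G \<longleftrightarrow> (\<exists>S. finite S \<and> S \<subseteq> carrier G \<and> generate G S = carrier G)"

section \<open>Characters\<close>

definition real_group :: "real monoid" where
  "real_group = \<lparr>carrier = UNIV, monoid.mult = (+), one = 0\<rparr>"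

definition is_character :: "('a, 'b) monoid_scheme \<Rightarrow> ('a \<Rightarrow> real) \<Rightarrow> bool" where
  "is_character G \<chi> \<longleftrightarrow> \<chi> \<in> hom G real_group \<and> (\<exists>g \<in> carrier G. \<chi> g \<noteq> 0)"

definition is_rational_character :: "('a, 'b) monoid_scheme \<Rightarrow> ('a \<Rightarrow> real) \<Rightarrow> bool" where
  "is_rational_character G \<chi> \<longleftrightarrow>
     is_character G \<chi> \<and> (\<exists>c > 0. \<forall>g \<in> carrier G. c * \<chi> g \<in> \<int>)"

section \<open>Graph groups\<close>

text \<open>Graphs are symmetric digraphs, so every edge contributes its commutation relation twice.\<close>

definition graph_relations :: "('a, 'b) pre_digraph \<Rightarrow> ('a gen_word \<times> 'a gen_word) set" where
  "graph_relations \<G> = {([(x, True), (y, True)], [(y, True), (x, True)]) | x y. x \<rightarrow>\<^bsub>\<G>\<^esub> y}"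

definition graph_group :: "('a, 'b) pre_digraph \<Rightarrow> 'a gen_word set monoid" where
  "graph_group \<G> = presented_group (verts \<G>) (graph_relations \<G>)"

definition std_generator :: "('a, 'b) pre_digraph \<Rightarrow> 'a \<Rightarrow> 'a gen_word set" where
  "std_generator \<G> v = pres_cong (verts \<G>) (graph_relations \<G>) `` {[(v, True)]}"

lemma group_graph_group: "group (graph_group \<G>)"
  by (simp add: graph_group_def group_presented_group)

lemma std_generator_in_carrier: "v \<in> verts \<G> \<Longrightarrow> std_generator \<G> v \<in> carrier (graph_group \<G>)"
  by (simp add: graph_group_def std_generator_def presented_group_carrierI)

definition living_subgraph :: "('a, 'b) pre_digraph \<Rightarrow> ('a gen_word set \<Rightarrow> real) \<Rightarrow> ('a, 'b) pre_digraph" where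
  "living_subgraph \<G> \<chi> = induce_subgraph \<G> {v \<in> verts \<G>. \<chi> (std_generator \<G> v) \<noteq> 0}"

definition dominating :: "('a, 'b) pre_digraph \<Rightarrow> ('a, 'b) pre_digraph \<Rightarrow> bool" where
  "dominating \<L> \<G> \<longleftrightarrow> (\<forall>v \<in> verts \<G> - verts \<L>. \<exists>u \<in> verts \<L>. v \<rightarrow>\<^bsub>\<G>\<^esub> u)"

end

theory Submission
  imports Defs
begin

text \<open>
  After scaling, the character is an integer-valued homomorphism \<open>\<nu>\<close>.

  Suppose the living subgraph is connected and dominating. Each living vertex \<open>u\<close> has a power \<open>u'\<close> of
  a common height \<open>N\<close>. Choose elements \<open>x i\<close> of height \<open>i\<close> and let \<open>H\<close> be generated by the kernel
  elements \<open>x i * s * (x (i + \<nu> s))\<inverse>\<close> with \<open>s\<close> a generator and \<open>0 \<le> i < 2 * N\<close>. The cosets \<open>H x i\<close> in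
  this window are permuted by the generators according to height. This persists when the window grows:
  the powers \<open>u'\<close> of adjacent living vertices commute, so all \<open>u'\<close> move a given coset to the same new one,
  and a dead vertex fixes the new coset as it commutes with some \<open>u'\<close>. Hence \<open>H\<close> is the whole kernel.

  Conversely, let the group act on the real line by affine maps with linear parts \<open>2 powi \<nu> g\<close> and dyadic
  translation parts. The kernel acts by translations, and conjugation makes the set of translation
  lengths invariant under division by \<open>2 ^ k\<close> for some \<open>k > 0\<close>; such a group of dyadic rationals
  is finitely generated only if it is zero. If the living subgraph is disconnected, let one component fix
  \<open>0\<close> and the others \<open>1\<close>; if a dead vertex has no living neighbour, let it translate by \<open>1\<close>. In both
  cases some kernel element acts nontrivially.
\<close>

section \<open>Integer-valued homomorphisms\<close>

text \<open>Heights are integers rather than reals so that they can serve as exponents of 2 and be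
  reduced modulo \<open>N\<close>.\<close>

locale int_valued_hom = group G for G (structure) +
  fixes \<nu> :: "'a \<Rightarrow> int"
  assumes \<nu>_mult: "g \<in> carrier G \<Longrightarrow> h \<in> carrier G \<Longrightarrow> \<nu> (g \<otimes> h) = \<nu> g + \<nu> h"
begin

lemma \<nu>_one: "\<nu> \<one> = 0"
  using \<nu>_mult[of \<one> \<one>] by simp

lemma \<nu>_inv: "g \<in> carrier G \<Longrightarrow> \<nu> (inv g) = - \<nu> g"
  using \<nu>_mult[of g "inv g"] \<nu>_one by simp

lemma \<nu>_pow: "g \<in> carrier G \<Longrightarrow> \<nu> (g [^] (k::nat)) = int k * \<nu> g"
  by (induction k) (auto simp: \<nu>_mult \<nu>_one algebra_simps)

lemma \<nu>_int_pow: "g \<in> carrier G \<Longrightarrow> \<nu> (g [^] (k::int)) = k * \<nu> g"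
  by (cases k rule: int_cases2) (auto simp: int_pow_neg int_pow_int \<nu>_pow \<nu>_inv)

lemma subgroup_\<nu>_kernel: "subgroup {g \<in> carrier G. \<nu> g = 0} G"
  by (rule subgroupI) (auto simp: \<nu>_inv \<nu>_mult \<nu>_one intro: exI[of _ \<one>])

text \<open>A set generates the same elements inside a subgroup containing it as in the ambient
  group, so generators of the kernel can be handled in \<open>G\<close> itself.\<close>

lemma finitely_generated_\<nu>_kernel_iff:
  "finitely_generated (G\<lparr>carrier := {g \<in> carrier G. \<nu> g = 0}\<rparr>) \<longleftrightarrow>
   (\<exists>F. finite F \<and> F \<subseteq> {g \<in> carrier G. \<nu> g = 0} \<and> generate G F = {g \<in> carrier G. \<nu> g = 0})"
  unfolding finitely_generated_def
  by (intro arg_cong[where f = Ex] ext conj_cong refl)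
    (simp_all add: generate_consistent[OF _ subgroup_\<nu>_kernel])

end

section \<open>Finite generation of the kernel\<close>

text \<open>
  \<open>C i\<close> will be a coset at height \<open>i\<close>, \<open>S v\<close> the action of a living generator raising heights by
  \<open>m v\<close>, and \<open>T d\<close> that of a dead one. The powers \<open>S v ^^ p v\<close> all raise heights by the same \<open>N\<close>.
\<close>

locale height_action =
  fixes X :: "'x set" and L D :: "'v set" and adj :: "'v \<Rightarrow> 'v \<Rightarrow> bool"
    and S T :: "'v \<Rightarrow> 'x \<Rightarrow> 'x" and m :: "'v \<Rightarrow> int" and p :: "'v \<Rightarrow> nat" and N :: int
    and I :: "int set" and C :: "int \<Rightarrow> 'x" and w :: 'v
  assumes S_closed: "v \<in> L \<Longrightarrow> c \<in> X \<Longrightarrow> S v c \<in> X"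
    and S_comm: "u \<in> L \<Longrightarrow> v \<in> L \<Longrightarrow> adj u v \<Longrightarrow> c \<in> X \<Longrightarrow> S u (S v c) = S v (S u c)"
    and T_comm: "d \<in> D \<Longrightarrow> \<exists>u\<in>L. \<forall>c\<in>X. T d (S u c) = S u (T d c)"
    and m_pos: "v \<in> L \<Longrightarrow> m v > 0"
    and p_m: "v \<in> L \<Longrightarrow> int (p v) * m v = N"
    and N_pos: "N > 0"
    and I_minus: "i \<in> I \<Longrightarrow> v \<in> L \<Longrightarrow> i - m v \<in> I"
    and I_plus: "i \<in> I \<Longrightarrow> v \<in> L \<Longrightarrow> i + m v \<in> I"
    and C_closed: "i \<in> I \<Longrightarrow> C i \<in> X"
    and w: "w \<in> L"
    and hat_w: "i \<in> I \<Longrightarrow> (S w ^^ p w) (C i) = C (i + N)"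
    and connected: "v \<in> L \<Longrightarrow> (w, v) \<in> {(u, v). u \<in> L \<and> v \<in> L \<and> adj u v}\<^sup>*"
begin

text \<open>Both ends of a living step must lie in the window, so raising \<open>b\<close> by one
  adds only conditions at the height \<open>b + 1\<close>.\<close>

definition compatible_on :: "int \<Rightarrow> int \<Rightarrow> bool" where
  "compatible_on a b \<longleftrightarrow>
     (\<forall>i\<in>I. \<forall>v\<in>L. a \<le> i \<and> i + m v \<le> b \<longrightarrow> S v (C i) = C (i + m v)) \<and>
     (\<forall>i\<in>I. \<forall>d\<in>D. a \<le> i \<and> i \<le> b \<longrightarrow> T d (C i) = C i)"

lemma funpow_closed: "v \<in> L \<Longrightarrow> c \<in> X \<Longrightarrow> (S v ^^ k) c \<in> X"
  by (induction k) (auto intro: S_closed)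

lemma funpow_comm:
  assumes "u \<in> L" "v \<in> L" "adj u v" "c \<in> X"
  shows "(S u ^^ j) ((S v ^^ k) c) = (S v ^^ k) ((S u ^^ j) c)"
proof -
  have 1: "S u ((S v ^^ k) c) = (S v ^^ k) (S u c)" if "c \<in> X" for c k
    using that assms(1-3) by (induction k) (simp_all add: S_comm[of u v] funpow_closed)
  show ?thesis
    using assms by (induction j) (auto simp: 1 funpow_closed)
qed

lemma I_minus_mult: "i \<in> I \<Longrightarrow> v \<in> L \<Longrightarrow> i - int k * m v \<in> I"
proof (induction k)
  case (Suc k)
  then show ?case using I_minus[of "i - int k * m v" v] by (simp add: algebra_simps)
qed simp

lemma I_plus_mult: "i \<in> I \<Longrightarrow> v \<in> L \<Longrightarrow> i + int k * m v \<in> I"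
proof (induction k)
  case (Suc k)
  then show ?case using I_plus[of "i + int k * m v" v] by (simp add: algebra_simps)
qed simp

lemma I_minus_N: "i \<in> I \<Longrightarrow> i - N \<in> I"
  using I_minus_mult[of i w "p w"] w p_m[of w] by simp

lemma compatible_on_funpow:
  assumes "compatible_on a b" "v \<in> L" "i \<in> I" "a \<le> i" "i + int k * m v \<le> b"
  shows "(S v ^^ k) (C i) = C (i + int k * m v)"
  using assms(5)
proof (induction k)
  case (Suc k)
  have le: "i + int k * m v + m v \<le> b" using Suc.prems by (simp add: algebra_simps)
  then have "i + int k * m v \<le> b" using m_pos[OF assms(2)] by simp
  then have "(S v ^^ Suc k) (C i) = S v (C (i + int k * m v))" using Suc.IH by simp
  also have "\<dots> = C (i + int k * m v + m v)"
  proof -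
    have "a \<le> i + int k * m v" using assms(4) m_pos[OF assms(2)] by (simp add: add_increasing2)
    then show ?thesis
      using assms(1,2) le I_plus_mult[OF assms(3,2)] unfolding compatible_on_def by blast
  qed
  finally show ?case by (simp add: algebra_simps)
qed simp

text \<open>
  If \<open>u\<close> and \<open>v\<close> are adjacent, then applying their \<open>N\<close>-step powers in either order to \<open>C (b + 1 - 2 * N)\<close>
  shows that both powers send \<open>C (b + 1 - N)\<close> to the same point; by connectivity this point is
  \<open>C (b + 1)\<close> for every living vertex.
\<close>

lemma compatible_on_step:
  assumes A: "compatible_on a b" and ab: "2 * N - 1 \<le> b - a"
  shows "compatible_on a (b + 1)"
proof -
  have key: "(\<forall>v\<in>L. S v (C (b + 1 - m v)) = C (b + 1)) \<and> (\<forall>d\<in>D. T d (C (b + 1)) = C (b + 1))"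
    if iI: "b + 1 \<in> I"
  proof -
    \<comment> \<open>The bound on \<open>b - a\<close> is what keeps \<open>b + 1 - 2 * N\<close>,
      the start of two successive \<open>N\<close>-steps, at or above \<open>a\<close>.\<close>
    define i where "i = b + 1"
    have i: "i \<in> I" "i - N \<in> I" "i - 2 * N \<in> I"
      using iI I_minus_N[of i] I_minus_N[of "i - N"] by (auto simp: i_def algebra_simps)
    have hat: "(S u ^^ p u) (C (i - 2 * N)) = C (i - N)" if "u \<in> L" for u
      using compatible_on_funpow[OF A that i(3), of "p u"] p_m[OF that] ab N_pos
      by (simp add: i_def)
    have eq: "(S u ^^ p u) (C (i - N)) = (S v ^^ p v) (C (i - N))"
      if "u \<in> L" "v \<in> L" "adj u v" for u v
      using funpow_comm[OF that C_closed[OF i(3)], of "p u" "p v"] hat that by simp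
    have top: "(S u ^^ p u) (C (i - N)) = C i" if "u \<in> L" for u
      using connected[OF that]
    proof (induction rule: rtrancl_induct)
      case base
      then show ?case using hat_w[OF i(2)] by simp
    next
      case (step u v)
      then show ?case using eq[of u v] by simp
    qed
    \<comment> \<open>Of the \<open>p v\<close> steps from \<open>C (i - N)\<close> to
      \<open>C i\<close>, all but the last stay in the old window and reach
      \<open>C (i - m v)\<close>; this determines the last one.\<close>
    have "S v (C (i - m v)) = C i" if v: "v \<in> L" for v
    proof -
      have "p v \<noteq> 0" using p_m[OF v] N_pos by (cases "p v") auto
      then obtain k where k: "p v = Suc k" using not0_implies_Suc by blast
      have e: "i - N + int k * m v = i - m v"
        using p_m[OF v] k by (simp add: algebra_simps)
      have "(S v ^^ k) (C (i - N)) = C (i - m v)"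
        using compatible_on_funpow[OF A v i(2), of k] ab N_pos m_pos[OF v] unfolding e
        by (simp add: i_def)
      then show ?thesis using top[OF v] k by simp
    qed
    \<comment> \<open>\<open>T d\<close> commutes with the powers of some \<open>S u\<close>, so its
      fixed point \<open>C (i - N)\<close> is carried to another fixed point,
      \<open>C i\<close>.\<close>
    moreover have "T d (C i) = C i" if d: "d \<in> D" for d
    proof -
      obtain u where u: "u \<in> L" "\<And>c. c \<in> X \<Longrightarrow> T d (S u c) = S u (T d c)"
        using T_comm[OF d] by blast
      have "T d ((S u ^^ k) (C (i - N))) = (S u ^^ k) (T d (C (i - N)))" for k
        using u by (induction k) (auto simp: funpow_closed C_closed[OF i(2)])
      moreover have "T d (C (i - N)) = C (i - N)"
        using A d i(2) ab N_pos unfolding compatible_on_def by (auto simp: i_def)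
      ultimately show ?thesis using top[OF u(1)] by metis
    qed
    ultimately show ?thesis by (simp add: i_def)
  qed
  show ?thesis
    unfolding compatible_on_def
  proof (intro conjI ballI impI)
    fix i v assume iv: "i \<in> I" "v \<in> L" "a \<le> i \<and> i + m v \<le> b + 1"
    show "S v (C i) = C (i + m v)"
    proof (cases "i + m v = b + 1")
      case True
      then show ?thesis using key I_plus[OF iv(1,2)] iv(2)
        by (metis add_diff_cancel_right')
    next
      case False
      then show ?thesis using A iv unfolding compatible_on_def by auto
    qed
  next
    fix i d assume "i \<in> I" "d \<in> D" "a \<le> i \<and> i \<le> b + 1"
    then show "T d (C i) = C i"
      using A key unfolding compatible_on_def by (cases "i = b + 1") auto
  qed
qed

lemma compatible_on_extend:
  assumes "compatible_on a b" "2 * N - 1 \<le> b - a"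
  shows "compatible_on a (b + int k)"
proof (induction k)
  case (Suc k)
  then show ?case using compatible_on_step[of a "b + int k"] assms(2) by (simp add: algebra_simps)
qed (use assms in simp)

end

section \<open>Right cosets of a finitely generated subgroup of the kernel\<close>

lemma (in group) r_coset_funpow:
  assumes "c \<subseteq> carrier G" "g \<in> carrier G"
  shows "((\<lambda>c. c #> g) ^^ k) c = c #> (g [^] k)"
  using assms by (induction k) (auto simp: coset_mult_assoc)

text \<open>The only relations used are commutations along chains joining the living generators and
  between each dead generator and some living one, so the group need not be a graph group.\<close>

lemma (in int_valued_hom) kernel_finitely_generated:
  fixes \<gamma> :: "'v \<Rightarrow> 'a" and L D :: "'v set"
  assumes fin: "finite L" "finite D"
    and \<gamma>: "\<gamma> ` (L \<union> D) \<subseteq> carrier G" "generate G (\<gamma> ` (L \<union> D)) = carrier G"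
    and L: "\<And>v. v \<in> L \<Longrightarrow> \<nu> (\<gamma> v) \<noteq> 0" and D: "\<And>d. d \<in> D \<Longrightarrow> \<nu> (\<gamma> d) = 0"
    and w: "w \<in> L"
    and connected: "\<And>v. v \<in> L \<Longrightarrow>
      (w, v) \<in> {(u, v). u \<in> L \<and> v \<in> L \<and> \<gamma> u \<otimes> \<gamma> v = \<gamma> v \<otimes> \<gamma> u}\<^sup>*"
    and dom: "\<And>d. d \<in> D \<Longrightarrow> \<exists>u\<in>L. \<gamma> d \<otimes> \<gamma> u = \<gamma> u \<otimes> \<gamma> d"
  shows "\<exists>F. finite F \<and> F \<subseteq> {g \<in> carrier G. \<nu> g = 0} \<and> generate G F = {g \<in> carrier G. \<nu> g = 0}"
proof -
  let ?K = "{g \<in> carrier G. \<nu> g = 0}"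
  have \<gamma>_c: "\<gamma> v \<in> carrier G" if "v \<in> L \<union> D" for v using \<gamma>(1) that by auto

  \<comment> \<open>Orienting every living generator upwards makes all living steps positive;
    inversion preserves commutation.\<close>
  define \<sigma> where "\<sigma> v = (if \<nu> (\<gamma> v) > 0 then \<gamma> v else inv (\<gamma> v))" for v
  define m where "m v = \<bar>\<nu> (\<gamma> v)\<bar>" for v
  define N where "N = (\<Prod>v\<in>L. m v)"
  define p where "p v = nat (N div m v)" for v
  define I where "I = \<nu> ` carrier G"
  have \<sigma>_c [simp]: "\<sigma> v \<in> carrier G" if "v \<in> L" for v using \<gamma>_c that by (simp add: \<sigma>_def)
  have \<nu>_\<sigma>: "\<nu> (\<sigma> v) = m v" if "v \<in> L" for v
    using \<gamma>_c that L[OF that] by (auto simp: \<sigma>_def m_def \<nu>_inv)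
  have m_pos: "m v > 0" if "v \<in> L" for v using L[OF that] by (simp add: m_def)
  have N_pos: "N > 0" unfolding N_def by (intro prod_pos) (use m_pos in auto)
  have p_m: "int (p v) * m v = N" if "v \<in> L" for v
  proof -
    have "m v dvd N" unfolding N_def using fin that by (intro dvd_prodI) auto
    moreover have "N div m v \<ge> 0" using N_pos m_pos[OF that] by (simp add: pos_imp_zdiv_nonneg_iff)
    ultimately show ?thesis by (simp add: p_def)
  qed
  have I_add: "i + j \<in> I" if "i \<in> I" "j \<in> I" for i j
    using that by (auto simp: I_def simp flip: \<nu>_mult intro!: imageI)
  have I_neg: "- i \<in> I" if "i \<in> I" for i
    using that by (auto simp: I_def simp flip: \<nu>_inv intro!: imageI)
  have I_m: "m v \<in> I" if "v \<in> L" for v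
    using that by (auto simp: I_def simp flip: \<nu>_\<sigma> intro!: imageI)
  define z where "z = \<sigma> w [^] p w"
  have z_c [simp]: "z \<in> carrier G" using w by (simp add: z_def)
  have \<nu>_z: "\<nu> z = N" using w by (simp add: z_def \<nu>_pow \<nu>_\<sigma> p_m)
  have I_N: "N \<in> I" unfolding \<nu>_z[symmetric] by (auto simp: I_def)

  \<comment> \<open>A section \<open>x\<close> of \<open>\<nu>\<close> over its image that is equivariant under the shift by \<open>N\<close>.\<close>
  define y where "y r = (SOME g. g \<in> carrier G \<and> \<nu> g = r)" for r
  have y: "y r \<in> carrier G" "\<nu> (y r) = r" if "r \<in> I" for r
  proof -
    have "\<exists>g. g \<in> carrier G \<and> \<nu> g = r" using that by (auto simp: I_def)
    from someI_ex[OF this] show "y r \<in> carrier G" "\<nu> (y r) = r" by (auto simp: y_def)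
  qed
  define x where "x i = y (i mod N) \<otimes> z [^] (i div N)" for i
  have I_mod: "i mod N \<in> I" if "i \<in> I" for i
  proof -
    have "- (i div N) * N \<in> I"
      unfolding I_def by (rule image_eqI[of _ _ "z [^] (- (i div N))"]) (auto simp: \<nu>_int_pow \<nu>_z)
    from I_add[OF that this] show ?thesis by (simp add: minus_div_mult_eq_mod)
  qed
  have x: "x i \<in> carrier G" "\<nu> (x i) = i" if "i \<in> I" for i
    using y[OF I_mod[OF that]] by (auto simp: x_def \<nu>_mult \<nu>_int_pow \<nu>_z)
  have x_shift: "x i \<otimes> z = x (i + N)" if "i \<in> I" for i
    using y[OF I_mod[OF that]] N_pos
    by (simp add: x_def m_assoc int_pow_mult[of z _ 1, simplified])

  \<comment> \<open>\<open>F\<close> consists of the Schreier generators of the kernel for the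
    transversal \<open>x\<close>, restricted to starting heights from 0 to
    \<open>2 * N - 1\<close>.\<close>
  define W where "W = I \<inter> {0..2 * N - 1}"
  define F where "F = (\<lambda>(i, v). x i \<otimes> \<sigma> v \<otimes> inv (x (i + m v))) ` (W \<times> L) \<union>
      (\<lambda>(i, d). x i \<otimes> \<gamma> d \<otimes> inv (x i)) ` (W \<times> D)"
  define H where "H = generate G F"
  have "finite W" by (simp add: W_def)
  then have finF: "finite F" using fin by (simp add: F_def)
  have FK: "F \<subseteq> ?K"
    unfolding F_def W_def
    using x I_m I_add \<gamma>_c D by (auto simp: \<nu>_mult \<nu>_inv \<nu>_\<sigma>)
  have H: "subgroup H G" unfolding H_def using FK by (intro generate_is_subgroup) auto
  have Hc: "H \<subseteq> carrier G" using H by (rule subgroup.subset)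
  have HK: "H \<subseteq> ?K" unfolding H_def by (rule generate_subgroup_incl[OF FK subgroup_\<nu>_kernel])
  have coset_eqI: "H #> g = H #> h" if "g \<otimes> inv h \<in> H" "g \<in> carrier G" "h \<in> carrier G" for g h
    using that Hc by (intro coset_mult_inv1 coset_join2 H) auto

  define C where "C i = H #> x i" for i
  have C_sub: "C i \<subseteq> carrier G" if "i \<in> I" for i
    using x that Hc by (simp add: C_def r_coset_subset_G)
  have coset_comm: "c #> g #> h = c #> h #> g"
    if "c \<subseteq> carrier G" "g \<otimes> h = h \<otimes> g" "g \<in> carrier G" "h \<in> carrier G" for c g h
    using that by (simp add: coset_mult_assoc)
  have inv_comm: "g \<otimes> inv h = inv h \<otimes> g"
    if "g \<otimes> h = h \<otimes> g" "g \<in> carrier G" "h \<in> carrier G" for g h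
    using that by (metis inv_closed inv_solve_left inv_solve_right m_assoc m_closed)
  have \<sigma>_comm_right: "g \<otimes> \<sigma> u = \<sigma> u \<otimes> g"
    if "g \<otimes> \<gamma> u = \<gamma> u \<otimes> g" "u \<in> L" "g \<in> carrier G" for g u
    using that inv_comm[of g "\<gamma> u"] \<gamma>_c[of u] by (auto simp: \<sigma>_def)
  have \<sigma>_comm: "\<sigma> u \<otimes> \<sigma> v = \<sigma> v \<otimes> \<sigma> u"
    if "\<gamma> u \<otimes> \<gamma> v = \<gamma> v \<otimes> \<gamma> u" "u \<in> L" "v \<in> L" for u v
    using \<sigma>_comm_right[of "\<gamma> u" v] \<sigma>_comm_right[of "\<sigma> v" u] that \<gamma>_c[of u] by simp
  have cancel: "c #> \<sigma> v #> inv (\<sigma> v) = c" "c #> inv (\<sigma> v) #> \<sigma> v = c"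
    if "c \<subseteq> carrier G" "v \<in> L" for c v
    using that by (simp_all add: coset_mult_assoc)

  define adj where "adj u v \<longleftrightarrow> \<gamma> u \<otimes> \<gamma> v = \<gamma> v \<otimes> \<gamma> u" for u v
  have connected': "(w, v) \<in> {(u, v). u \<in> L \<and> v \<in> L \<and> adj u v}\<^sup>*" if "v \<in> L" for v
    using connected[OF that] by (simp add: adj_def)

  \<comment> \<open>All subsets of the carrier serve as points, so closure under the action is
    immediate.\<close>
  interpret up: height_action "Pow (carrier G)" L D adj "\<lambda>v c. c #> \<sigma> v" "\<lambda>d c. c #> \<gamma> d"
    m p N I C w
  proof
    fix u v c assume "u \<in> L" "v \<in> L" "adj u v" "c \<in> Pow (carrier G)"
    then show "c #> \<sigma> v #> \<sigma> u = c #> \<sigma> u #> \<sigma> v"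
      by (intro coset_comm) (auto simp: adj_def \<sigma>_comm)
  next
    fix d assume d: "d \<in> D"
    then obtain u where "u \<in> L" "\<gamma> d \<otimes> \<gamma> u = \<gamma> u \<otimes> \<gamma> d" using dom by blast
    then show "\<exists>u\<in>L. \<forall>c\<in>Pow (carrier G). c #> \<sigma> u #> \<gamma> d = c #> \<gamma> d #> \<sigma> u"
      using d \<gamma>_c[of d] coset_comm[of _ "\<sigma> u" "\<gamma> d"] \<sigma>_comm_right[of "\<gamma> d" u]
      by (intro bexI[of _ u]) auto
  next
    fix i assume i: "i \<in> I"
    show "((\<lambda>c. c #> \<sigma> w) ^^ p w) (C i) = C (i + N)"
      using x[OF i] x_shift[OF i] Hc w
      by (simp add: r_coset_funpow C_sub[OF i] flip: z_def) (simp add: C_def coset_mult_assoc)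
  next
    fix i v assume "i \<in> I" "v \<in> L"
    then show "i - m v \<in> I" "i + m v \<in> I"
      using I_add[of i "- m v"] I_add I_neg I_m by auto
  qed (use m_pos p_m N_pos w connected' C_sub in
      \<open>auto simp: r_coset_subset_G\<close>)

  \<comment> \<open>Negating heights and inverting the living generators gives another such action;
    extending its window upwards extends the original window downwards.\<close>
  interpret down: height_action "Pow (carrier G)" L D adj "\<lambda>v c. c #> inv (\<sigma> v)" "\<lambda>d c. c #> \<gamma> d"
    m p N I "\<lambda>i. C (- i)" w
  proof
    fix u v c assume "u \<in> L" "v \<in> L" "adj u v" "c \<in> Pow (carrier G)"
    then show "c #> inv \<sigma> v #> inv \<sigma> u = c #> inv \<sigma> u #> inv \<sigma> v"
      by (intro coset_comm) (auto simp: adj_def \<sigma>_comm simp flip: inv_mult_group)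
  next
    fix d assume d: "d \<in> D"
    then obtain u where "u \<in> L" "\<gamma> d \<otimes> \<gamma> u = \<gamma> u \<otimes> \<gamma> d" using dom by blast
    then show "\<exists>u\<in>L. \<forall>c\<in>Pow (carrier G). c #> inv (\<sigma> u) #> \<gamma> d = c #> \<gamma> d #> inv (\<sigma> u)"
      using d \<gamma>_c[of d] coset_comm[of _ "inv (\<sigma> u)" "\<gamma> d"] \<sigma>_comm_right[of "\<gamma> d" u]
        inv_comm[of "\<gamma> d" "\<sigma> u"]
      by (intro bexI[of _ u]) auto
  next
    fix i assume i: "i \<in> I"
    have j: "- i - N \<in> I" using I_add[of "- i" "- N"] I_neg i I_N by auto
    have "C (- i) = C (- i - N) #> z"
      using x_shift[OF j] x(1)[OF j] Hc by (simp add: C_def coset_mult_assoc)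
    then have "C (- i) #> inv z = C (- i - N)"
      using C_sub[OF j] by (simp add: coset_mult_assoc)
    then show "((\<lambda>c. c #> inv (\<sigma> w)) ^^ p w) (C (- i)) = C (- (i + N))"
      using w C_sub[OF I_neg[OF i]]
      by (simp add: r_coset_funpow z_def nat_pow_inv)
  qed (use m_pos p_m N_pos w connected' C_sub I_neg up.I_minus up.I_plus in
      \<open>auto simp: r_coset_subset_G\<close>)

  have up_down: "down.compatible_on (- b) (- a)" if "up.compatible_on a b" for a b
    unfolding down.compatible_on_def
  proof (intro conjI ballI impI)
    fix i v assume iv: "i \<in> I" "v \<in> L" "- b \<le> i \<and> i + m v \<le> - a"
    let ?j = "- (i + m v)"
    have j: "?j \<in> I" using iv I_neg up.I_plus by blast
    have "C ?j #> \<sigma> v = C (?j + m v)"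
      using that iv j unfolding up.compatible_on_def by auto
    then show "C (- i) #> inv (\<sigma> v) = C ?j"
      using cancel(1)[OF C_sub[OF j] iv(2)] by simp
  next
    fix i d assume "i \<in> I" "d \<in> D" "- b \<le> i \<and> i \<le> - a"
    then show "C (- i) #> \<gamma> d = C (- i)"
      using that I_neg unfolding up.compatible_on_def by auto
  qed
  have start: "up.compatible_on 0 (2 * N - 1)"
    unfolding up.compatible_on_def
  proof (intro conjI ballI impI)
    fix i v assume iv: "i \<in> I" "v \<in> L" "0 \<le> i \<and> i + m v \<le> 2 * N - 1"
    then have "i \<in> W" using m_pos[of v] by (auto simp: W_def)
    then have "x i \<otimes> \<sigma> v \<otimes> inv (x (i + m v)) \<in> H"
      unfolding H_def F_def using iv by (auto intro!: generate.incl)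
    then show "C i #> \<sigma> v = C (i + m v)"
      using x(1)[OF iv(1)] x(1)[OF up.I_plus[OF iv(1,2)]] iv(2) Hc
        coset_eqI[of "x i \<otimes> \<sigma> v" "x (i + m v)"]
      by (simp add: C_def coset_mult_assoc)
  next
    fix i d assume id: "i \<in> I" "d \<in> D" "0 \<le> i \<and> i \<le> 2 * N - 1"
    then have "i \<in> W" by (auto simp: W_def)
    then have "x i \<otimes> \<gamma> d \<otimes> inv (x i) \<in> H"
      unfolding H_def F_def using id by (auto intro!: generate.incl)
    then show "C i #> \<gamma> d = C i"
      using x(1)[OF id(1)] id(2) Hc \<gamma>_c[of d] coset_eqI[of "x i \<otimes> \<gamma> d" "x i"]
      by (simp add: C_def coset_mult_assoc)
  qed
  \<comment> \<open>Extend upwards by \<open>k\<close>, reverse, and extend by \<open>k\<close>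
    again: the cosets follow heights on the whole range from \<open>- k\<close> to
    \<open>2 * N - 1 + k\<close>.\<close>
  have all: "down.compatible_on (- (2 * N - 1) - int k) (int k)" for k
  proof -
    have "down.compatible_on (- (2 * N - 1 + int k)) (- 0)"
      by (intro up_down up.compatible_on_extend start) simp
    from down.compatible_on_extend[OF this, of k] show ?thesis by (simp add: algebra_simps)
  qed
  have step_\<sigma>: "C i #> inv (\<sigma> v) = C (i - m v)" if "i \<in> I" "v \<in> L" for i v
  proof -
    let ?k = "nat (\<bar>i\<bar> + m v)"
    have "int ?k = \<bar>i\<bar> + m v" using m_pos[OF that(2)] by simp
    then have "- (2 * N - 1) - int ?k \<le> - i \<and> - i + m v \<le> int ?k"
      using N_pos m_pos[OF that(2)] by linarith
    then have "C (- (- i)) #> inv (\<sigma> v) = C (- (- i + m v))"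
      using all[of ?k] that I_neg[OF that(1)] unfolding down.compatible_on_def by blast
    then show ?thesis by simp
  qed
  have step_\<gamma>: "C i #> \<gamma> v = C (i + \<nu> (\<gamma> v))" if i: "i \<in> I" and "v \<in> L \<union> D" for i v
  proof (cases "v \<in> L")
    case v: True
    show ?thesis
    proof (cases "\<nu> (\<gamma> v) > 0")
      case True
      have "C (i + m v) #> inv (\<sigma> v) = C i" using step_\<sigma>[OF up.I_plus[OF i v] v] by simp
      then have "C i #> \<sigma> v = C (i + m v)" using cancel(2)[OF C_sub[OF up.I_plus[OF i v]] v] by simp
      then show ?thesis using True by (simp add: \<sigma>_def m_def)
    next
      case False
      then show ?thesis using step_\<sigma>[OF i v] \<gamma>_c v by (simp add: \<sigma>_def m_def)
    qed
  next
    case False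
    then have d: "v \<in> D" using that by simp
    let ?k = "nat \<bar>i\<bar>"
    have "- (2 * N - 1) - int ?k \<le> - i \<and> - i \<le> int ?k" using N_pos by linarith
    then have "C (- (- i)) #> \<gamma> v = C (- (- i))"
      using all[of ?k] d I_neg[OF i] unfolding down.compatible_on_def by blast
    then show ?thesis using D[OF d] by simp
  qed
  \<comment> \<open>Each generator now acts as expected at every height, so every element shifts the
    cosets by its own height.\<close>
  have act: "\<forall>i\<in>I. C i #> g = C (i + \<nu> g)" if "g \<in> generate G (\<gamma> ` (L \<union> D))" for g
    using that
  proof (induction rule: generate.induct)
    case one
    then show ?case using C_sub \<nu>_one by simp
  next
    case (incl h)
    then show ?case using step_\<gamma> by auto
  next
    case (inv h)
    show ?case
    proof
      fix i assume i: "i \<in> I"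
      have h: "h \<in> carrier G" using inv \<gamma>_c by auto
      have j: "i + \<nu> (inv h) \<in> I" using h i I_add by (auto simp: I_def)
      have "C (i + \<nu> (inv h)) #> h = C i" using inv step_\<gamma>[OF j] h \<nu>_inv by auto
      then have "C i #> inv h = C (i + \<nu> (inv h)) #> h #> inv h" by simp
      then show "C i #> inv h = C (i + \<nu> (inv h))"
        using C_sub[OF j] h by (simp add: coset_mult_assoc)
    qed
  next
    case (eng g h)
    have gh: "g \<in> carrier G" "h \<in> carrier G" using eng.hyps \<gamma>(2) by auto
    show ?case
    proof
      fix i assume i: "i \<in> I"
      have "i + \<nu> g \<in> I" using i gh I_add by (auto simp: I_def)
      then show "C i #> (g \<otimes> h) = C (i + \<nu> (g \<otimes> h))"
        using eng.IH i gh C_sub[OF i]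
        by (simp add: \<nu>_mult add.assoc flip: coset_mult_assoc)
    qed
  qed
  have "?K \<subseteq> H"
  proof
    fix k assume k: "k \<in> ?K"
    have 0: "0 \<in> I" using \<nu>_one by (force simp: I_def)
    note x0 = x[OF 0]
    \<comment> \<open>The representative \<open>x 0\<close> is an arbitrary choice of height 0 and
      need not be the identity; conjugating by it turns the fixing of \<open>H #> x 0\<close> into
      \<open>H #> k = H\<close>.\<close>
    let ?g = "inv (x 0) \<otimes> k \<otimes> x 0"
    have g: "?g \<in> carrier G" "\<nu> ?g = 0" using k x0 by (auto simp: \<nu>_mult \<nu>_inv)
    then have "H #> x 0 #> ?g = H #> x 0" using act[of ?g] \<gamma>(2) 0 by (simp add: C_def)
    moreover have "x 0 \<otimes> ?g = k \<otimes> x 0" using x0 k by (simp flip: m_assoc)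
    ultimately have "H #> (k \<otimes> x 0) = H #> x 0"
      using x0 g Hc by (simp add: coset_mult_assoc)
    then have "H #> (k \<otimes> x 0 \<otimes> inv (x 0)) = H"
      using x0 k Hc by (intro coset_mult_inv2) auto
    then have "H #> k = H" using x0 k by (simp add: m_assoc)
    then show "k \<in> H" using coset_join1[OF _ _ H] k by blast
  qed
  then have "generate G F = ?K" using HK unfolding H_def by (rule subset_antisym[rotated])
  then show ?thesis using finF FK by (intro exI[of _ F] conjI)
qed

section \<open>Crossed homomorphisms to the dyadic rationals\<close>

definition dyadic_reals :: "real set" where
  "dyadic_reals = {a. \<exists>N::nat. 2 ^ N * a \<in> \<int>}"

lemma dyadic_reals_int: "of_int a \<in> dyadic_reals"
  by (auto simp: dyadic_reals_def intro!: exI[of _ 0])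

lemma dyadic_reals_power_mono:
  assumes "2 ^ M * a \<in> \<int>" "M \<le> N"
  shows "2 ^ N * (a :: real) \<in> \<int>"
proof -
  have "2 ^ (N - M) * (2 ^ M * a) \<in> \<int>" using assms(1) by (intro Ints_mult[OF _ assms(1)]) auto
  moreover have "2 ^ (N - M) * (2 ^ M * a) = 2 ^ N * a"
    using assms(2) by (simp flip: power_add mult.assoc)
  ultimately show ?thesis by metis
qed

lemma dyadic_reals_add:
  assumes "a \<in> dyadic_reals" "b \<in> dyadic_reals"
  shows "a + b \<in> dyadic_reals"
proof -
  obtain M N :: nat where MN: "2 ^ M * a \<in> \<int>" "2 ^ N * b \<in> \<int>"
    using assms by (auto simp: dyadic_reals_def)
  have "2 ^ max M N * a + 2 ^ max M N * b \<in> \<int>"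
    by (intro Ints_add MN[THEN dyadic_reals_power_mono]) auto
  then show ?thesis by (auto simp: dyadic_reals_def distrib_left)
qed

lemma dyadic_reals_minus: "a \<in> dyadic_reals \<Longrightarrow> - a \<in> dyadic_reals"
  by (auto simp: dyadic_reals_def)

lemma dyadic_reals_power_int_mult:
  assumes "a \<in> dyadic_reals"
  shows "2 powi e * a \<in> dyadic_reals"
proof -
  obtain N :: nat where N: "2 ^ N * a \<in> \<int>" using assms by (auto simp: dyadic_reals_def)
  have "2 ^ (N + nat (- e)) * (2 powi e * a) = 2 ^ nat e * (2 ^ N * a)"
    by (cases e rule: int_cases2) (auto simp: power_add power_int_minus field_simps)
  also have "\<dots> \<in> \<int>" by (intro Ints_mult[OF _ N]) auto
  finally show ?thesis unfolding dyadic_reals_def by blast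
qed

text \<open>
  On the kernel \<open>\<delta>\<close> is additive, so finitely many generators bound the denominators of its values;
  but conjugation by \<open>g\<close> multiplies these values by \<open>2 powi \<nu> g\<close>.
\<close>

lemma (in int_valued_hom) crossed_hom_vanishes_on_kernel:
  fixes \<delta> :: "'a \<Rightarrow> real"
  assumes \<delta>_mult: "\<And>g h. g \<in> carrier G \<Longrightarrow> h \<in> carrier G \<Longrightarrow> \<delta> (g \<otimes> h) = \<delta> g + 2 powi \<nu> g * \<delta> h"
    and dyadic: "\<And>g. g \<in> carrier G \<Longrightarrow> \<delta> g \<in> dyadic_reals"
    and fin: "finite F" "F \<subseteq> {g \<in> carrier G. \<nu> g = 0}" "generate G F = {g \<in> carrier G. \<nu> g = 0}"
    and nontrivial: "h \<in> carrier G" "\<nu> h \<noteq> 0"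
    and k: "k \<in> carrier G" "\<nu> k = 0"
  shows "\<delta> k = 0"
proof (rule ccontr)
  assume nz: "\<delta> k \<noteq> 0"
  let ?K = "{g \<in> carrier G. \<nu> g = 0}"
  have \<delta>_one: "\<delta> \<one> = 0" using \<delta>_mult[of \<one> \<one>] \<nu>_one by simp
  have \<delta>_inv: "\<delta> g + 2 powi \<nu> g * \<delta> (inv g) = 0" if "g \<in> carrier G" for g
    using \<delta>_mult[of g "inv g"] that \<delta>_one by simp
  obtain M where M: "2 ^ M g * \<delta> g \<in> \<int>" if "g \<in> carrier G" for g
    using dyadic unfolding dyadic_reals_def mem_Collect_eq by metis
  \<comment> \<open>The sum bounds every \<open>M g\<close> with \<open>g\<close> in
    \<open>F\<close>, so \<open>2 ^ N\<close> clears the denominators of all generators at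
    once.\<close>
  define N where "N = (\<Sum>g\<in>F. M g)"
  have F: "2 ^ N * \<delta> g \<in> \<int>" if "g \<in> F" for g
  proof -
    have "M g \<le> N" unfolding N_def using fin(1) that by (intro member_le_sum) auto
    then show ?thesis using dyadic_reals_power_mono M[of g] that fin(2) by blast
  qed
  have K: "g \<in> ?K \<and> 2 ^ N * \<delta> g \<in> \<int>" if "g \<in> generate G F" for g
    using that
  proof (induction rule: generate.induct)
    case one
    then show ?case by (simp add: \<delta>_one \<nu>_one)
  next
    case (incl g)
    then show ?case using F fin(2) by auto
  next
    case (inv g)
    then have g: "g \<in> carrier G" "\<nu> g = 0" using fin(2) by auto
    then have "\<delta> (inv g) = - \<delta> g" using \<delta>_inv[of g] by simp
    then show ?case using F[OF inv] g \<nu>_inv[of g] by simp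
  next
    case (eng g h)
    then show ?case by (auto simp: \<nu>_mult \<delta>_mult distrib_left)
  qed
  have conj: "2 ^ N * (2 powi \<nu> g * \<delta> k) \<in> \<int>" if g: "g \<in> carrier G" for g
  proof -
    have "\<nu> (g \<otimes> k \<otimes> inv g) = 0" using g k by (simp add: \<nu>_mult \<nu>_inv)
    then have "2 ^ N * \<delta> (g \<otimes> k \<otimes> inv g) \<in> \<int>" using K fin(3) g k by auto
    moreover have "\<delta> (g \<otimes> k \<otimes> inv g) = 2 powi \<nu> g * \<delta> k"
      using \<delta>_inv[OF g] g k by (simp add: \<delta>_mult \<nu>_mult)
    ultimately show ?thesis by simp
  qed
  obtain g where g: "g \<in> carrier G" "\<nu> g \<le> - 1"
  proof (cases "\<nu> h < 0")
    case True
    then show ?thesis using that[of h] nontrivial by simp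
  next
    case False
    then show ?thesis using that[of "inv h"] nontrivial \<nu>_inv[of h] by simp
  qed
  \<comment> \<open>\<open>j\<close> is chosen so that conjugating by \<open>g [^] j\<close> brings
    the integer \<open>?q\<close> below 1 in absolute value, which leaves only 0.\<close>
  obtain j where j: "2 ^ N * \<bar>\<delta> k\<bar> < 2 ^ j"
    using real_arch_pow[of 2 "2 ^ N * \<bar>\<delta> k\<bar>"] by auto
  let ?e = "\<nu> (g [^] j)"
  let ?q = "2 ^ N * (2 powi ?e * \<delta> k)"
  have "?e = int j * \<nu> g" using g by (simp add: \<nu>_pow)
  also have "\<dots> \<le> int j * (- 1)" using g by (intro mult_left_mono) auto
  finally have "?e \<le> - int j" by simp
  then have le: "(2::real) powi ?e \<le> 1 / 2 ^ j"
    using \<open>?e \<le> - int j\<close> power_int_increasing[of ?e "- int j" "2::real"]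
    by (simp add: power_int_minus field_simps)
  have "\<bar>?q\<bar> = 2 powi ?e * (2 ^ N * \<bar>\<delta> k\<bar>)" by (simp add: abs_mult)
  also have "\<dots> \<le> 1 / 2 ^ j * (2 ^ N * \<bar>\<delta> k\<bar>)" using le by (intro mult_right_mono) auto
  also have "\<dots> < 1" using j by (simp add: field_simps)
  finally have "?q = 0" using conj[of "g [^] j"] g Ints_nonzero_abs_less1 by fastforce
  then show False using nz by simp
qed

section \<open>Affine actions of words on the real line\<close>

fun word_height :: "('a \<Rightarrow> int) \<Rightarrow> 'a gen_word \<Rightarrow> int" where
  "word_height n [] = 0"
| "word_height n ((x, b) # w) = (if b then n x else - n x) + word_height n w"

text \<open>
  The translation part of the affine map represented by a word when \<open>x\<close> acts on the real line as
  \<open>\<lambda>s. 2 powi n x * s + t x\<close>.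
\<close>

fun word_crossed_hom :: "('a \<Rightarrow> int) \<Rightarrow> ('a \<Rightarrow> real) \<Rightarrow> 'a gen_word \<Rightarrow> real" where
  "word_crossed_hom n t [] = 0"
| "word_crossed_hom n t ((x, True) # w) = t x + 2 powi n x * word_crossed_hom n t w"
| "word_crossed_hom n t ((x, False) # w) = 2 powi (- n x) * (word_crossed_hom n t w - t x)"

lemma word_height_append: "word_height n (u @ v) = word_height n u + word_height n v"
  by (induction n u rule: word_height.induct) auto

lemma word_crossed_hom_append:
  "word_crossed_hom n t (u @ v) = word_crossed_hom n t u + 2 powi word_height n u * word_crossed_hom n t v"
  by (induction n t u rule: word_crossed_hom.induct)
    (auto simp: power_int_add power_int_diff power_int_minus field_simps)

text \<open>The hypothesis on \<open>t\<close> says that the affine maps of adjacent vertices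
  commute. The action therefore respects the defining relations of the graph group.\<close>

lemma pres_cong_invariants:
  assumes "(u, v) \<in> pres_cong X (graph_relations \<G>)"
    and "\<And>x y. x \<rightarrow>\<^bsub>\<G>\<^esub> y \<Longrightarrow> t x + 2 powi n x * t y = t y + 2 powi n y * t x"
  shows "word_height n u = word_height n v \<and> word_crossed_hom n t u = word_crossed_hom n t v"
  using assms(1)
proof (induction rule: pres_cong.induct)
  case (cancel x b)
  then show ?case by (cases b) (auto simp: power_int_minus field_simps)
next
  case (relation l r)
  then show ?case using assms(2) by (auto simp: graph_relations_def)
qed (auto simp: word_height_append word_crossed_hom_append)

lemma word_crossed_hom_dyadic:
  assumes "w \<in> gen_words X" "\<And>x. x \<in> X \<Longrightarrow> t x \<in> dyadic_reals"
  shows "word_crossed_hom n t w \<in> dyadic_reals"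
  using assms
proof (induction n t w rule: word_crossed_hom.induct)
  case (1 n t)
  then show ?case using dyadic_reals_int[of 0] by simp
next
  case (2 n t x w)
  then show ?case by (auto intro!: dyadic_reals_add dyadic_reals_power_int_mult)
next
  case (3 n t x w)
  then show ?case
    using dyadic_reals_add[OF _ dyadic_reals_minus, of "word_crossed_hom n t w" "t x"]
    by (auto intro!: dyadic_reals_power_int_mult)
qed

section \<open>Graph groups\<close>

abbreviation word_class :: "('a, 'b) pre_digraph \<Rightarrow> 'a gen_word \<Rightarrow> 'a gen_word set" where
  "word_class \<G> w \<equiv> pres_cong (verts \<G>) (graph_relations \<G>) `` {w}"

lemma word_class_mult:
  "u \<in> gen_words (verts \<G>) \<Longrightarrow> v \<in> gen_words (verts \<G>) \<Longrightarrow>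
   word_class \<G> u \<otimes>\<^bsub>graph_group \<G>\<^esub> word_class \<G> v = word_class \<G> (u @ v)"
  unfolding graph_group_def by (rule presented_group_mult)

lemma word_class_carrier:
  "w \<in> gen_words (verts \<G>) \<Longrightarrow> word_class \<G> w \<in> carrier (graph_group \<G>)"
  unfolding graph_group_def by (rule presented_group_carrierI)

lemma graph_group_carrierE:
  assumes "A \<in> carrier (graph_group \<G>)"
  obtains w where "w \<in> gen_words (verts \<G>)" "A = word_class \<G> w"
  using assms unfolding graph_group_def by (rule presented_group_carrierE)

lemma word_class_Cons:
  assumes "v \<in> verts \<G>" "w \<in> gen_words (verts \<G>)"
  shows "word_class \<G> ((v, b) # w) =
    (if b then std_generator \<G> v else inv\<^bsub>graph_group \<G>\<^esub> std_generator \<G> v) \<otimes>\<^bsub>graph_group \<G>\<^esub> word_class \<G> w"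
proof -
  interpret group "graph_group \<G>" by (rule group_graph_group)
  have "word_class \<G> [(v, False)] = inv\<^bsub>graph_group \<G>\<^esub> std_generator \<G> v"
  proof (rule inv_equality[symmetric])
    have "word_class \<G> ([(v, False)] @ [(v, True)]) = word_class \<G> []"
      using equiv_class_eq[OF equiv_pres_cong pres_cong.cancel[OF assms(1), of False]] by simp
    then show "word_class \<G> [(v, False)] \<otimes>\<^bsub>graph_group \<G>\<^esub> std_generator \<G> v = \<one>\<^bsub>graph_group \<G>\<^esub>"
      using assms(1) unfolding std_generator_def
      by (subst word_class_mult) (auto simp: graph_group_def presented_group_one)
  qed (use assms in \<open>auto simp: std_generator_in_carrier intro!: word_class_carrier\<close>)
  then have "word_class \<G> [(v, b)] = (if b then std_generator \<G> v else inv\<^bsub>graph_group \<G>\<^esub> std_generator \<G> v)"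
    by (simp add: std_generator_def)
  then show ?thesis
    using word_class_mult[of "[(v, b)]" \<G> w] assms by simp
qed

lemma graph_group_generated:
  "generate (graph_group \<G>) (std_generator \<G> ` verts \<G>) = carrier (graph_group \<G>)"
proof
  interpret group "graph_group \<G>" by (rule group_graph_group)
  show "generate (graph_group \<G>) (std_generator \<G> ` verts \<G>) \<subseteq> carrier (graph_group \<G>)"
    by (intro generate_incl) (auto simp: std_generator_in_carrier)
  have "word_class \<G> w \<in> generate (graph_group \<G>) (std_generator \<G> ` verts \<G>)"
    if "w \<in> gen_words (verts \<G>)" for w
    using that
  proof (induction w)
    case Nil
    then show ?case
      using generate.one[of "graph_group \<G>"] by (simp add: graph_group_def presented_group_one)
  next
    case (Cons a w)
    then show ?case
      by (cases a) (auto simp: word_class_Cons intro!: generate.eng intro: generate.incl generate.inv)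
  qed
  then show "carrier (graph_group \<G>) \<subseteq> generate (graph_group \<G>) (std_generator \<G> ` verts \<G>)"
    by (auto elim: graph_group_carrierE)
qed

lemma std_generator_commute:
  assumes "x \<rightarrow>\<^bsub>\<G>\<^esub> y" "x \<in> verts \<G>" "y \<in> verts \<G>"
  shows "std_generator \<G> x \<otimes>\<^bsub>graph_group \<G>\<^esub> std_generator \<G> y =
    std_generator \<G> y \<otimes>\<^bsub>graph_group \<G>\<^esub> std_generator \<G> x"
proof -
  have "([(x, True), (y, True)], [(y, True), (x, True)]) \<in> pres_cong (verts \<G>) (graph_relations \<G>)"
    using assms by (intro pres_cong.relation) (auto simp: graph_relations_def)
  from equiv_class_eq[OF equiv_pres_cong this] show ?thesis
    using assms unfolding std_generator_def by (simp add: word_class_mult)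
qed

text \<open>A homomorphism is determined by its values on generators; this identifies the abstract
  height with the exponent computed letter by letter.\<close>

lemma height_word_class:
  assumes "int_valued_hom (graph_group \<G>) \<nu>"
    and "w \<in> gen_words (verts \<G>)"
  shows "\<nu> (word_class \<G> w) = word_height (\<lambda>v. \<nu> (std_generator \<G> v)) w"
proof -
  interpret int_valued_hom "graph_group \<G>" \<nu> by fact
  show ?thesis
    using assms(2)
  proof (induction w)
    case Nil
    then show ?case using \<nu>_one by (simp add: graph_group_def presented_group_one)
  next
    case (Cons a w)
    then show ?case
      by (cases a) (auto simp: word_class_Cons \<nu>_mult \<nu>_inv std_generator_in_carrier word_class_carrier)
  qed
qed

text \<open>Connectivity is defined by reachability in the symmetric closure. The arcs are symmetric
  already, so chains of adjacent vertices of \<open>U\<close> suffice.\<close>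

lemma (in graph) connected_induce_subgraph_iff:
  assumes "U \<subseteq> verts G"
  shows "Digraph_Component.connected (G \<restriction> U) \<longleftrightarrow>
    U \<noteq> {} \<and> (\<forall>u\<in>U. \<forall>v\<in>U. (u, v) \<in> {(u, v). u \<in> U \<and> v \<in> U \<and> u \<rightarrow>\<^bsub>G\<^esub> v}\<^sup>*)"
proof -
  interpret H: wf_digraph "G \<restriction> U" by auto
  have sym: "symmetric (G \<restriction> U)"
    using assms sym_arcs by (auto intro: induced_graph_imp_symmetric)
  have ends: "arcs_ends (G \<restriction> U) = {(u, v). u \<in> U \<and> v \<in> U \<and> u \<rightarrow>\<^bsub>G\<^esub> v}"
    by (auto simp: arcs_ends_conv)
  have "u \<rightarrow>\<^sup>*\<^bsub>with_proj (mk_symmetric (G \<restriction> U))\<^esub> v \<longleftrightarrow>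
      (u, v) \<in> {(u, v). u \<in> U \<and> v \<in> U \<and> u \<rightarrow>\<^bsub>G\<^esub> v}\<^sup>*" if "u \<in> U" "v \<in> U" for u v
  proof -
    have "u \<rightarrow>\<^sup>*\<^bsub>G \<restriction> U\<^esub> v \<longleftrightarrow> (u, v) \<in> (arcs_ends (G \<restriction> U))\<^sup>*"
      unfolding reachable_def ends induce_subgraph_verts
      using that by (blast intro: rtrancl_on_rtranclI rtrancl_consistent_rtrancl_on)
    then show ?thesis by (simp only: H.reachable_mk_symmetric_eq[OF sym] ends)
  qed
  then show ?thesis
    unfolding Digraph_Component.connected_def strongly_connected_def by simp
qed

text \<open>Used as an obstruction: an affine action prescribed on the vertices in which some word
  of height 0 has nonzero translation part rules out finite generation.\<close>

lemma graph_group_crossed_hom_vanishes_on_kernel: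
  fixes t :: "'a \<Rightarrow> real"
  assumes \<nu>: "int_valued_hom (graph_group \<G>) \<nu>"
    and nontrivial: "\<exists>h\<in>carrier (graph_group \<G>). \<nu> h \<noteq> 0"
    and fg: "finitely_generated
      ((graph_group \<G>)\<lparr>carrier := {g \<in> carrier (graph_group \<G>). \<nu> g = 0}\<rparr>)"
    and n: "n = (\<lambda>v. \<nu> (std_generator \<G> v))"
    and t: "\<And>v. v \<in> verts \<G> \<Longrightarrow> t v \<in> dyadic_reals"
    and adj: "\<And>x y. x \<rightarrow>\<^bsub>\<G>\<^esub> y \<Longrightarrow> t x + 2 powi n x * t y = t y + 2 powi n y * t x"
    and w: "w \<in> gen_words (verts \<G>)" "word_height n w = 0"
  shows "word_crossed_hom n t w = 0"
proof -
  interpret int_valued_hom "graph_group \<G>" \<nu> by fact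
  let ?G = "graph_group \<G>"
  obtain F where F: "finite F" "F \<subseteq> {g \<in> carrier ?G. \<nu> g = 0}"
    "generate ?G F = {g \<in> carrier ?G. \<nu> g = 0}"
    using fg unfolding finitely_generated_\<nu>_kernel_iff by blast
  \<comment> \<open>The value is read off a chosen representative; invariance under the congruence
    makes the choice immaterial.\<close>
  define \<delta> where "\<delta> A = word_crossed_hom n t (SOME u. u \<in> A)" for A
  have \<delta>: "\<delta> (word_class \<G> u) = word_crossed_hom n t u" if u: "u \<in> gen_words (verts \<G>)" for u
  proof -
    have "u \<in> word_class \<G> u" using pres_cong.refl[OF u] by simp
    then have "(SOME v. v \<in> word_class \<G> u) \<in> word_class \<G> u" by (rule someI)
    then have "(u, SOME v. v \<in> word_class \<G> u) \<in> pres_cong (verts \<G>) (graph_relations \<G>)" by simp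
    from pres_cong_invariants[OF this adj] show ?thesis by (simp add: \<delta>_def)
  qed
  have height: "\<nu> (word_class \<G> u) = word_height n u" if "u \<in> gen_words (verts \<G>)" for u
    unfolding n using \<nu> that by (rule height_word_class)
  obtain h where h: "h \<in> carrier ?G" "\<nu> h \<noteq> 0" using nontrivial by blast
  have "\<delta> (word_class \<G> w) = 0"
  proof (rule crossed_hom_vanishes_on_kernel[OF _ _ F h])
    fix g k assume "g \<in> carrier ?G" "k \<in> carrier ?G"
    then show "\<delta> (g \<otimes>\<^bsub>?G\<^esub> k) = \<delta> g + 2 powi \<nu> g * \<delta> k"
      by (auto elim!: graph_group_carrierE simp: word_class_mult \<delta> height word_crossed_hom_append)
  next
    fix g assume "g \<in> carrier ?G"
    then show "\<delta> g \<in> dyadic_reals"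
      using t by (auto elim!: graph_group_carrierE simp: \<delta> intro!: word_crossed_hom_dyadic)
  qed (use w word_class_carrier height in auto)
  then show ?thesis using \<delta> w by simp
qed

theorem theorem6p1:
  fixes \<G> :: "('a, 'b) pre_digraph"
    and \<chi> :: "'a gen_word set \<Rightarrow> real"
  assumes "graph \<G>"
    and "is_rational_character (graph_group \<G>) \<chi>"
  shows "finitely_generated
           ((graph_group \<G>)\<lparr>carrier := kernel (graph_group \<G>) real_group \<chi>\<rparr>) \<longleftrightarrow>
         Digraph_Component.connected (living_subgraph \<G> \<chi>) \<and> dominating (living_subgraph \<G> \<chi>) \<G>"
proof -
  interpret graph \<G> by fact
  interpret group "graph_group \<G>" by (rule group_graph_group)
  let ?G = "graph_group \<G>"
  let ?\<gamma> = "std_generator \<G>"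
  have adj_verts: "x \<in> verts \<G>" "y \<in> verts \<G>" if "x \<rightarrow>\<^bsub>\<G>\<^esub> y" for x y
    using that adj_in_verts by auto
  have adj_sym: "y \<rightarrow>\<^bsub>\<G>\<^esub> x" if "x \<rightarrow>\<^bsub>\<G>\<^esub> y" for x y
    using that sym_arcs by (rule arcs_ends_symmetric[rotated])
  obtain c where c: "c > 0" "\<And>g. g \<in> carrier ?G \<Longrightarrow> c * \<chi> g \<in> \<int>"
    using assms(2) unfolding is_rational_character_def by blast
  have \<chi>_mult: "\<chi> (g \<otimes>\<^bsub>?G\<^esub> h) = \<chi> g + \<chi> h" if "g \<in> carrier ?G" "h \<in> carrier ?G" for g h
    using assms(2) that
    unfolding is_rational_character_def is_character_def hom_def real_group_def by auto
  have \<chi>_nontrivial: "\<exists>g\<in>carrier ?G. \<chi> g \<noteq> 0"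
    using assms(2) unfolding is_rational_character_def is_character_def by blast
  \<comment> \<open>On the carrier \<open>c * \<chi> g\<close> is already an integer, so the floor
    only changes the type.\<close>
  define \<nu> where "\<nu> g = \<lfloor>c * \<chi> g\<rfloor>" for g
  have \<nu>: "real_of_int (\<nu> g) = c * \<chi> g" if "g \<in> carrier ?G" for g
    using c(2)[OF that] by (auto simp: \<nu>_def elim: Ints_cases)
  have \<nu>_mult: "\<nu> (g \<otimes>\<^bsub>?G\<^esub> h) = \<nu> g + \<nu> h" if "g \<in> carrier ?G" "h \<in> carrier ?G" for g h
  proof -
    have "real_of_int (\<nu> (g \<otimes>\<^bsub>?G\<^esub> h)) = real_of_int (\<nu> g + \<nu> h)"
      using that by (simp add: \<nu> \<chi>_mult distrib_left)
    then show ?thesis by (simp only: of_int_eq_iff)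
  qed
  have hom: "int_valued_hom ?G \<nu>" by unfold_locales (rule \<nu>_mult)
  interpret int_valued_hom ?G \<nu> by (rule hom)
  have \<nu>_0: "\<nu> g = 0 \<longleftrightarrow> \<chi> g = 0" if "g \<in> carrier ?G" for g
    using \<nu>[OF that] c(1) by auto
  have \<nu>_nontrivial: "\<exists>g\<in>carrier ?G. \<nu> g \<noteq> 0" using \<chi>_nontrivial \<nu>_0 by blast
  have K: "kernel ?G real_group \<chi> = {g \<in> carrier ?G. \<nu> g = 0}"
    using \<nu>_0 by (auto simp: kernel_def real_group_def)
  define n where "n = (\<lambda>v. \<nu> (?\<gamma> v))"
  define L where "L = {v \<in> verts \<G>. n v \<noteq> 0}"
  have LV: "L \<subseteq> verts \<G>" by (auto simp: L_def)
  have living: "living_subgraph \<G> \<chi> = \<G> \<restriction> L"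
    using \<nu>_0[OF std_generator_in_carrier] unfolding living_subgraph_def L_def n_def
    by (metis (mono_tags, lifting))
  \<comment> \<open>Connectivity includes nonemptiness. If every generator were dead, all heights
    would vanish, but the character is nonzero.\<close>
  have L_ne: "L \<noteq> {}"
  proof
    assume "L = {}"
    then have "word_height n w = 0" if "w \<in> gen_words (verts \<G>)" for w
      using that by (induction w) (auto simp: L_def)
    then show False
      using \<nu>_nontrivial height_word_class[OF hom] unfolding n_def
      by (auto elim!: graph_group_carrierE)
  qed
  note connected_iff = connected_induce_subgraph_iff[OF LV]
  show ?thesis
    unfolding K living
  proof
    assume fg: "finitely_generated (?G\<lparr>carrier := {g \<in> carrier ?G. \<nu> g = 0}\<rparr>)"
    note vanish = graph_group_crossed_hom_vanishes_on_kernel[OF hom \<nu>_nontrivial fg n_def]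
    have "Digraph_Component.connected (\<G> \<restriction> L)"
    proof (rule ccontr)
      assume "\<not> ?thesis"
      then obtain a b where ab: "a \<in> L" "b \<in> L"
        and nconn: "(a, b) \<notin> {(u, v). u \<in> L \<and> v \<in> L \<and> u \<rightarrow>\<^bsub>\<G>\<^esub> v}\<^sup>*"
        using connected_iff L_ne by blast
      define A where "A = {v. (a, v) \<in> {(u, v). u \<in> L \<and> v \<in> L \<and> u \<rightarrow>\<^bsub>\<G>\<^esub> v}\<^sup>*}"
      define B where "B = L - A"
      have nab: "\<not> x \<rightarrow>\<^bsub>\<G>\<^esub> y" "\<not> y \<rightarrow>\<^bsub>\<G>\<^esub> x" if "x \<in> A" "y \<in> B" "x \<in> L" for x y
        using that adj_sym unfolding A_def B_def by (auto intro: rtrancl_into_rtrancl)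
      \<comment> \<open>\<open>A\<close> acts by affine maps fixing \<open>0\<close> and \<open>B\<close> by affine maps fixing \<open>1\<close>.\<close>
      define t where "t v = (if v \<in> B then 1 - 2 powi n v else 0 :: real)" for v
      \<comment> \<open>The commutator of \<open>a\<close> and \<open>b\<close> has height 0, but
        its translation part is nonzero because the two maps scale nontrivially about different
        fixed points.\<close>
      let ?w = "[(a, True), (b, True), (a, False), (b, False)]"
      have "word_crossed_hom n t ?w = 0"
      proof (rule vanish)
        fix v assume "v \<in> verts \<G>"
        show "t v \<in> dyadic_reals"
          using dyadic_reals_int[of 0] dyadic_reals_int[of 1]
            dyadic_reals_add[OF _ dyadic_reals_minus[OF dyadic_reals_power_int_mult], of 1 1 "n v"]
          by (simp add: t_def)
      next
        fix x y assume xy: "x \<rightarrow>\<^bsub>\<G>\<^esub> y"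
        \<comment> \<open>A vertex outside \<open>A\<close> and \<open>B\<close> is dead and acts as
          the identity. Since no edge joins \<open>A\<close> to \<open>B\<close>, any other edge
          joins two maps with a common fixed point, and these commute.\<close>
        have *: "n v = 0" if "v \<in> verts \<G>" "v \<notin> A" "v \<notin> B" for v
          using that by (auto simp: B_def L_def)
        have AL: "v \<in> L" if "v \<in> A" "v \<in> verts \<G>" for v
          using that(1) ab(1) unfolding A_def by (auto elim: rtranclE)
        have "n y = 0" if "x \<in> B" "y \<notin> B"
          using that xy *[of y] nab[of y x] AL[of y] adj_verts[OF xy] by blast
        moreover have "n x = 0" if "y \<in> B" "x \<notin> B"
          using that xy *[of x] nab[of x y] AL[of x] adj_verts[OF xy] by blast
        ultimately show "t x + 2 powi n x * t y = t y + 2 powi n y * t x"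
          unfolding t_def by (cases "x \<in> B"; cases "y \<in> B") (simp_all add: algebra_simps)
      qed (use ab LV in auto)
      moreover have "a \<notin> B" "b \<in> B" using nconn ab by (auto simp: A_def B_def)
      then have "word_crossed_hom n t ?w = (2 powi n a - 1) * (1 - 2 powi n b)"
        by (simp add: t_def power_int_minus field_simps)
      moreover have "n a \<noteq> 0" "n b \<noteq> 0" using ab by (auto simp: L_def)
      moreover have "(2::real) powi k \<noteq> 1" if "k \<noteq> 0" for k :: int
        using that power_int_strict_increasing[of 0 k "2::real"]
          power_int_strict_increasing[of k 0 "2::real"] by (cases "k > 0") auto
      ultimately show False by simp
    qed
    moreover have "dominating (\<G> \<restriction> L) \<G>"
    proof (rule ccontr)
      assume "\<not> ?thesis"
      then obtain v where v: "v \<in> verts \<G>" "v \<notin> L" "\<And>u. u \<in> L \<Longrightarrow> \<not> v \<rightarrow>\<^bsub>\<G>\<^esub> u"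
        unfolding dominating_def by auto
      \<comment> \<open>The dead vertex \<open>v\<close> translates by 1 and all other vertices fix
        0. The neighbours of \<open>v\<close> are dead and act as the identity, so the relations
        hold, while \<open>v\<close> itself lies in the kernel.\<close>
      define t where "t u = (if u = v then 1 else 0 :: real)" for u
      have "word_crossed_hom n t [(v, True)] = 0"
      proof (rule vanish)
        fix u
        show "t u \<in> dyadic_reals"
          using dyadic_reals_int[of 0] dyadic_reals_int[of 1] by (simp add: t_def)
      next
        fix x y assume xy: "x \<rightarrow>\<^bsub>\<G>\<^esub> y"
        then have "n y = 0" if "x = v" using v(3)[of y] that adj_verts by (auto simp: L_def)
        moreover have "n x = 0" if "y = v"
          using xy v(3)[of x] that adj_verts adj_sym by (auto simp: L_def)
        ultimately show "t x + 2 powi n x * t y = t y + 2 powi n y * t x"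
          by (auto simp: t_def)
      qed (use v in \<open>auto simp: L_def\<close>)
      then show False by (simp add: t_def)
    qed
    ultimately show "Digraph_Component.connected (\<G> \<restriction> L) \<and> dominating (\<G> \<restriction> L) \<G>" ..
  next
    assume "Digraph_Component.connected (\<G> \<restriction> L) \<and> dominating (\<G> \<restriction> L) \<G>"
    then have conn: "\<And>u v. u \<in> L \<Longrightarrow> v \<in> L \<Longrightarrow> (u, v) \<in> {(u, v). u \<in> L \<and> v \<in> L \<and> u \<rightarrow>\<^bsub>\<G>\<^esub> v}\<^sup>*"
      and dom: "\<And>d. d \<in> verts \<G> - L \<Longrightarrow> \<exists>u\<in>L. d \<rightarrow>\<^bsub>\<G>\<^esub> u"
      using connected_iff unfolding dominating_def by auto
    have comm: "?\<gamma> x \<otimes>\<^bsub>?G\<^esub> ?\<gamma> y = ?\<gamma> y \<otimes>\<^bsub>?G\<^esub> ?\<gamma> x" if "x \<rightarrow>\<^bsub>\<G>\<^esub> y" for x y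
      using that adj_verts by (intro std_generator_commute)
    obtain w where w: "w \<in> L" using L_ne by blast
    have union: "L \<union> (verts \<G> - L) = verts \<G>" using LV by blast
    show "finitely_generated (?G\<lparr>carrier := {g \<in> carrier ?G. \<nu> g = 0}\<rparr>)"
      unfolding finitely_generated_\<nu>_kernel_iff
    proof (rule kernel_finitely_generated[where L = L and D = "verts \<G> - L" and \<gamma> = ?\<gamma> and w = w])
      fix v assume v: "v \<in> L"
      \<comment> \<open>Adjacent generators commute, so a chain of living neighbours is a chain of
        commuting generators.\<close>
      have "{(u, v). u \<in> L \<and> v \<in> L \<and> u \<rightarrow>\<^bsub>\<G>\<^esub> v} \<subseteq>
          {(u, v). u \<in> L \<and> v \<in> L \<and> ?\<gamma> u \<otimes>\<^bsub>?G\<^esub> ?\<gamma> v = ?\<gamma> v \<otimes>\<^bsub>?G\<^esub> ?\<gamma> u}"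
        using comm by auto
      from rtrancl_mono[OF this] conn[OF w v]
      show "(w, v) \<in> {(u, v). u \<in> L \<and> v \<in> L \<and> ?\<gamma> u \<otimes>\<^bsub>?G\<^esub> ?\<gamma> v = ?\<gamma> v \<otimes>\<^bsub>?G\<^esub> ?\<gamma> u}\<^sup>*"
        by blast
    next
      fix d assume "d \<in> verts \<G> - L"
      then show "\<exists>u\<in>L. ?\<gamma> d \<otimes>\<^bsub>?G\<^esub> ?\<gamma> u = ?\<gamma> u \<otimes>\<^bsub>?G\<^esub> ?\<gamma> d"
        using dom comm by blast
    next
      show "finite L" using LV finite_verts finite_subset by blast
    next
      show "generate ?G (?\<gamma> ` (L \<union> (verts \<G> - L))) = carrier ?G"
        unfolding union by (rule graph_group_generated)
    next
      show "?\<gamma> ` (L \<union> (verts \<G> - L)) \<subseteq> carrier ?G"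
        unfolding union by (auto intro: std_generator_in_carrier)
    qed (use w in \<open>auto simp: L_def n_def\<close>)
  qed
qed

end
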